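(* Let $\Delta=(\mathfrak{D}_1,\dots,\mathfrak{D}_d)$ be a system of delta operators on $\mathbb{R}[x_1,\dots,x_d]$ with indicators $f_1,\dots,f_d$, let $\mathbf{g}=(g_1,\dots,g_d)$ be the compositional inverse of $\mathbf{f}=(f_1,\dots,f_d)$, and let $Z=\{z_{\mathbf{n}}:\mathbf{n}\in\mathbb{N}^d\}\subseteq\mathbb{R}^d$. Let $\{t_{\mathbf{n}}(\mathbf{x};Z)\}_{\mathbf{n}\in\mathbb{N}^d}$ be the delta Gončarov polynomials associated with $\Delta$ and $Z$. Then, as formal power series in $\mathbf{y}=(y_1,\dots,y_d)$ with coefficients in $\mathbb{R}[\mathbf{x}]$, $$e^{\mathbf{x}\cdot\mathbf{g}(\mathbf{y})}=\sum_{\mathbf{k}\in\mathbb{N}^d}\frac{t_{\mathbf{k}}(\mathbf{x};Z)}{\mathbf{k}!}\,\mathbf{y}^{\mathbf{k}}\,e^{z_{\mathbf{k}}\cdot\mathbf{g}(\mathbf{y})}.$$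
   Context: Shift-invariant operators on $\mathbb{R}[\mathbf{x}]$ commute with all shifts $f(\mathbf{x})\mapsto f(\mathbf{x}+\mathbf{v})$; each is uniquely $\sum_{\mathbf{n}}a_{\mathbf{n}}D_1^{n_1}\cdots D_d^{n_d}$ ($D_i=\partial/\partial x_i$), and its indicator is $\sum_{\mathbf{n}}a_{\mathbf{n}}\mathbf{x}^{\mathbf{n}}$. A system of delta operators is a $d$-tuple of shift-invariant linear operators such that for every nonzero $p=a_1x_1+\cdots+a_dx_d$ each $\mathfrak{D}_ip$ is a real constant $c_i$ and some $c_i\ne0$; equivalently the indicators have zero constant terms and the matrix of constant terms of $\partial f_i/\partial x_j$ is invertible, so $\mathbf{f}$ has a unique compositional inverse $\mathbf{g}$ (formal power series with zero constant terms such that $f_i(\mathbf{g}(\mathbf{x}))=x_i$ and $g_i(\mathbf{f}(\mathbf{x}))=x_i$ for all $i$). The basic sequence $\{p_{\mathbf{n}}\}$ of $\Delta$ is the unique family with $\deg p_{\mathbf{n}}=|\mathbf{n}|$, $p_{\mathbf{0}}=1$, $p_{\mathbf{n}}(\mathbf{0})=0$ for $|\mathbf{n}|\ge1$, $\mathfrak{D}_ip_{\mathbf{n}}=n_ip_{\mathbf{n}-\mathbf{e}_i}$; $\Pi^d_{\mathbf{n}}(\Delta)=\operatorname{span}\{p_{\mathbf{k}}:\mathbf{k}\le\mathbf{n}\}$ (componentwise order). The delta Gončarov polynomial $t_{\mathbf{n}}(\mathbf{x};Z)$ is the unique polynomial in $\Pi^d_{\mathbf{n}}(\Delta)$ with $\big[\mathfrak{D}_1^{k_1}\cdots\mathfrak{D}_d^{k_d}t_{\mathbf{n}}\big](z_{\mathbf{k}})=\mathbf{n}!\,\delta_{\mathbf{k},\mathbf{n}}$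 for all $\mathbf{k}\le\mathbf{n}$. Notation: $\mathbf{u}\cdot\mathbf{w}=\sum_iu_iw_i$, $\mathbf{y}^{\mathbf{k}}=\prod_iy_i^{k_i}$, $\mathbf{k}!=\prod_ik_i!$. *)

theory Defs
  imports "HOL-Analysis.Analysis" "HOL-Analysis.Finite_Function_Topology"
begin

text \<open>
  The index set \<open>{1, ..., d}\<close> is a type variable \<open>'d\<close> of sort \<open>{finite, linorder}\<close>; the linear
  order is needed only to compose operators in a definite order. The order of multi-indices
  is the componentwise one.
\<close>

type_synonym 'd multiindex = "nat^'d"

type_synonym 'd point = "real^'d"


section \<open>Multi-indices\<close>

definition mdeg :: "'d::finite multiindex \<Rightarrow> nat" where
  "mdeg n = (\<Sum>i\<in>UNIV. n $ i)"

definition mfact :: "'d::finite multiindex \<Rightarrow> real" where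
  "mfact n = (\<Prod>i\<in>UNIV. fact (n $ i))"

definition mpow :: "('d::finite \<Rightarrow> 'a::comm_monoid_mult) \<Rightarrow> 'd multiindex \<Rightarrow> 'a" where
  "mpow y n = (\<Prod>i\<in>UNIV. y i ^ (n $ i))"

text \<open>The operator \<open>D\<^sub>1 ^ n\<^sub>1 \<circ> \<dots> \<circ> D\<^sub>d ^ n\<^sub>d\<close>, composed in the order of the indices.\<close>

definition op_mpow :: "('d::{finite,linorder} \<Rightarrow> 'a \<Rightarrow> 'a) \<Rightarrow> 'd multiindex \<Rightarrow> 'a \<Rightarrow> 'a" where
  "op_mpow D n = foldr (\<lambda>i T. (D i ^^ (n $ i)) \<circ> T) (sorted_list_of_set UNIV) id"


section \<open>Polynomials\<close>

instance poly_mapping :: (monoid_add, real_algebra_1) real_algebra_1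
proof
  fix a :: real and x y :: "'a \<Rightarrow>\<^sub>0 'b"
  have lk: "Poly_Mapping.lookup (r *\<^sub>R p) k = r *\<^sub>R Poly_Mapping.lookup p k"
    for r and p :: "'a \<Rightarrow>\<^sub>0 'b" and k
    by (simp add: scaleR_poly_mapping_def)
  have left: "r *\<^sub>R p = Poly_Mapping.single 0 (of_real r) * p" for r and p :: "'a \<Rightarrow>\<^sub>0 'b"
    by (rule poly_mapping_eqI)
       (simp add: lk mult_map_scale_conv_mult[symmetric] map.rep_eq scaleR_conv_of_real when_def)
  show "a *\<^sub>R x * y = a *\<^sub>R (x * y)"
    by (simp add: left mult.assoc)
  have sum_any_scaleR: "Sum_any (\<lambda>k. a *\<^sub>R f k) = a *\<^sub>R Sum_any f" for f :: "'a \<Rightarrow> 'b"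
  proof (cases "a = 0")
    case False
    then show ?thesis by (simp add: Sum_any.expand_set scaleR_sum_right)
  qed simp
  have when_scaleR: "(a *\<^sub>R u when P) = a *\<^sub>R (u when P)" for u :: 'b and P
    by (simp add: when_def)
  show "x * a *\<^sub>R y = a *\<^sub>R (x * y)"
    by (rule poly_mapping_eqI) (simp add: lk lookup_mult when_scaleR sum_any_scaleR)
qed

type_synonym 'd mpoly = "'d multiindex \<Rightarrow>\<^sub>0 real"

definition mpoly_X :: "'d::finite \<Rightarrow> 'd mpoly" where
  "mpoly_X i = Poly_Mapping.single (axis i 1) 1"

definition mpoly_degree :: "'d::finite mpoly \<Rightarrow> nat" where
  "mpoly_degree p = (if p = 0 then 0 else Max (mdeg ` Poly_Mapping.keys p))"

definition mpoly_subst ::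
  "('d::finite \<Rightarrow> 'a::{comm_ring_1,real_algebra_1}) \<Rightarrow> 'd mpoly \<Rightarrow> 'a" where
  "mpoly_subst s p = (\<Sum>n\<in>Poly_Mapping.keys p. of_real (Poly_Mapping.lookup p n) * mpow s n)"

definition mpoly_eval :: "'d::finite mpoly \<Rightarrow> 'd point \<Rightarrow> real" where
  "mpoly_eval p v = mpoly_subst (\<lambda>i. v $ i) p"

definition mpoly_shift :: "'d::finite point \<Rightarrow> 'd mpoly \<Rightarrow> 'd mpoly" where
  "mpoly_shift v = mpoly_subst (\<lambda>i. mpoly_X i + of_real (v $ i))"

text \<open>If \<open>n $ i = 0\<close>, subtraction truncates, but the coefficient vanishes.\<close>

definition mpoly_deriv :: "'d::finite \<Rightarrow> 'd mpoly \<Rightarrow> 'd mpoly" where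
  "mpoly_deriv i p = (\<Sum>n\<in>Poly_Mapping.keys p.
     Poly_Mapping.single (n - axis i 1) (of_nat (n $ i) * Poly_Mapping.lookup p n))"


section \<open>Formal power series in several variables\<close>

typedef ('a, 'd) mfps = "UNIV :: ('d::finite multiindex \<Rightarrow> 'a) set"
  morphisms mfps_nth Abs_mfps ..

lemma mfps_nth_Abs [simp]: "mfps_nth (Abs_mfps f) = f"
  by (simp add: Abs_mfps_inverse)

lemma mfps_eqI: "(\<And>n. mfps_nth f n = mfps_nth g n) \<Longrightarrow> f = g"
  by (metis mfps_nth_inject ext)

lemma finite_multiindex_atMost: "finite {..n :: 'd::finite multiindex}"
proof -
  have "{..n} \<subseteq> (\<lambda>f. \<chi> i. f i) ` (PiE UNIV (\<lambda>i. {..n $ i}))"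
  proof
    fix k assume "k \<in> {..n}"
    then have "(\<lambda>i. k $ i) \<in> PiE UNIV (\<lambda>i. {..n $ i})"
      by (auto simp: less_eq_vec_def)
    moreover have "k = (\<chi> i. k $ i)" by simp
    ultimately show "k \<in> (\<lambda>f. \<chi> i. f i) ` (PiE UNIV (\<lambda>i. {..n $ i}))" by blast
  qed
  then show ?thesis by (rule finite_subset) (auto intro!: finite_PiE)
qed

instantiation mfps :: (comm_ring_1, finite) comm_ring_1
begin

definition "0 = Abs_mfps (\<lambda>n. 0)"
definition "1 = Abs_mfps (\<lambda>n. if n = 0 then 1 else 0)"
definition "f + g = Abs_mfps (\<lambda>n. mfps_nth f n + mfps_nth g n)"
definition "f - g = Abs_mfps (\<lambda>n. mfps_nth f n - mfps_nth g n)"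
definition "- f = Abs_mfps (\<lambda>n. - mfps_nth f n)"
definition "f * g = Abs_mfps (\<lambda>n. \<Sum>k\<le>n. mfps_nth f k * mfps_nth g (n - k))"

instance
proof
  note defs = zero_mfps_def one_mfps_def plus_mfps_def minus_mfps_def uminus_mfps_def times_mfps_def
  fix f g h :: "('a, 'b) mfps"
  have dd: "n - (n - k) = k" if "k \<le> n" for n k :: "'b multiindex"
    using that by (simp add: less_eq_vec_def vec_eq_iff)
  have bij: "(\<Sum>k\<le>n. F k (n - k)) = (\<Sum>k\<le>n. F (n - k) k)" for F :: "_ \<Rightarrow> _ \<Rightarrow> 'a" and n :: "nat^'b"
    by (rule sum.reindex_bij_witness[of _ "\<lambda>k. n - k" "\<lambda>k. n - k"])
       (simp_all add: dd, simp_all add: less_eq_vec_def)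
  show "f * g = g * f"
    by (rule mfps_eqI, simp add: defs, subst bij) (simp add: mult.commute)
  show "f * g * h = f * (g * h)"
  proof (rule mfps_eqI)
    fix n
    have 1: "j + l \<le> k" if "j \<le> k" "l \<le> k - j" for j k l :: "'b multiindex"
    proof -
      have "j $ i + l $ i \<le> k $ i" for i
        using that[unfolded less_eq_vec_def, THEN spec, of i] by simp
      then show ?thesis by (simp add: less_eq_vec_def)
    qed
    have 2: "j + (k - j) = k" if "j \<le> k" for j k :: "'b multiindex"
      using that by (simp add: less_eq_vec_def vec_eq_iff)
    have 3: "k - j \<le> m - j" if "k \<le> m" for j k m :: "'b multiindex"
      using that by (simp add: less_eq_vec_def diff_le_mono)
    have 4: "m - j - (k - j) = m - k" if "j \<le> k" for j k m :: "'b multiindex"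
      using that by (simp add: less_eq_vec_def vec_eq_iff)
    have 5: "j \<le> j + l" "j + l - j = l" for j l :: "'b multiindex"
      by (simp_all add: less_eq_vec_def vec_eq_iff)
    let ?f = "mfps_nth f" and ?g = "mfps_nth g" and ?h = "mfps_nth h"
    have "mfps_nth (f * g * h) n = (\<Sum>k\<le>n. \<Sum>j\<le>k. ?f j * ?g (k - j) * ?h (n - k))"
      by (simp add: defs sum_distrib_right)
    also have "\<dots> = (\<Sum>(k, j)\<in>(SIGMA k:{..n}. {..k}). ?f j * ?g (k - j) * ?h (n - k))"
      by (rule sum.Sigma) (auto simp: finite_multiindex_atMost)
    also have "\<dots> = (\<Sum>(j, l)\<in>(SIGMA j:{..n}. {..n - j}). ?f j * (?g l * ?h (n - j - l)))"
    proof (rule sum.reindex_bij_witness[of _ "\<lambda>(j, l). (j + l, j)" "\<lambda>(k, j). (j, k - j)"])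
      fix a assume "a \<in> (SIGMA k:{..n}. {..k})"
      then obtain k j where a: "a = (k, j)" "k \<le> n" "j \<le> k" by auto
      then have "j \<le> n" by (metis order_trans)
      show "(case case a of (k, j) \<Rightarrow> (j, k - j) of (j, l) \<Rightarrow> (j + l, j)) = a"
        using a(1) 2[OF a(3)] by simp
      show "(case a of (k, j) \<Rightarrow> (j, k - j)) \<in> (SIGMA j:{..n}. {..n - j})"
        using a(1) 3[OF a(2)] \<open>j \<le> n\<close> by simp
      show "(case case a of (k, j) \<Rightarrow> (j, k - j) of (j, l) \<Rightarrow> ?f j * (?g l * ?h (n - j - l)))
          = (case a of (k, j) \<Rightarrow> ?f j * ?g (k - j) * ?h (n - k))"
        using a(1) 4[OF a(3)] by (simp add: mult.assoc)
    next
      fix b assume "b \<in> (SIGMA j:{..n}. {..n - j})"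
      then obtain j l where b: "b = (j, l)" "j \<le> n" "l \<le> n - j" by auto
      show "(case case b of (j, l) \<Rightarrow> (j + l, j) of (k, j) \<Rightarrow> (j, k - j)) = b"
        using b(1) 5(2) by simp
      show "(case b of (j, l) \<Rightarrow> (j + l, j)) \<in> (SIGMA k:{..n}. {..k})"
        using b(1) 1[OF b(2,3)] 5(1) by simp
    qed
    also have "\<dots> = (\<Sum>j\<le>n. \<Sum>l\<le>n - j. ?f j * (?g l * ?h (n - j - l)))"
      by (rule sum.Sigma[symmetric]) (auto simp: finite_multiindex_atMost)
    also have "\<dots> = mfps_nth (f * (g * h)) n"
      by (simp add: defs sum_distrib_left)
    finally show "mfps_nth (f * g * h) n = mfps_nth (f * (g * h)) n" .
  qed
  show "1 * f = f"
  proof (rule mfps_eqI)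
    fix n :: "nat^'b"
    have "(0 :: nat^'b) \<le> n" by (simp add: less_eq_vec_def)
    then have "(\<Sum>k\<le>n. (if k = 0 then 1 else 0) * mfps_nth f (n - k)) = mfps_nth f (n - 0)"
      by (subst sum.mono_neutral_right[of _ "{0}"]) (auto simp: finite_multiindex_atMost)
    moreover have "n - 0 = n" by (simp add: vec_eq_iff)
    ultimately show "mfps_nth (1 * f) n = mfps_nth f n" by (simp add: defs)
  qed
  show "(f + g) * h = f * h + g * h"
    by (rule mfps_eqI) (simp add: defs distrib_right sum.distrib)
  show "(0 :: ('a, 'b) mfps) \<noteq> 1"
  proof
    assume "(0 :: ('a, 'b) mfps) = 1"
    then have "mfps_nth (0 :: ('a, 'b) mfps) 0 = mfps_nth 1 0" by (rule arg_cong)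
    then show False by (simp add: zero_mfps_def one_mfps_def)
  qed
qed (auto intro!: mfps_eqI simp: zero_mfps_def plus_mfps_def minus_mfps_def uminus_mfps_def add_ac)

end

instantiation mfps :: ("{comm_ring_1,real_algebra_1}", finite) real_algebra_1
begin

definition "r *\<^sub>R f = Abs_mfps (\<lambda>n. r *\<^sub>R mfps_nth f n)"

instance
  by standard
     (auto intro!: mfps_eqI simp: scaleR_mfps_def plus_mfps_def times_mfps_def
        scaleR_add_left scaleR_add_right scaleR_sum_right)

end

definition mfps_const :: "'a::zero \<Rightarrow> ('a, 'd::finite) mfps" where
  "mfps_const c = Abs_mfps (\<lambda>n. if n = 0 then c else 0)"

definition mfps_X :: "'d::finite \<Rightarrow> ('a::zero_neq_one, 'd) mfps" where
  "mfps_X i = Abs_mfps (\<lambda>n. if n = axis i 1 then 1 else 0)"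

definition mfps_map :: "('a \<Rightarrow> 'b) \<Rightarrow> ('a, 'd::finite) mfps \<Rightarrow> ('b, 'd) mfps" where
  "mfps_map h f = Abs_mfps (\<lambda>n. h (mfps_nth f n))"

text \<open>
  Formal summation: a family is summable if each coefficient vanishes for all but finitely many
  members, and is then summed coefficientwise.
\<close>

definition mfps_summable :: "('k \<Rightarrow> ('a::comm_monoid_add, 'd::finite) mfps) \<Rightarrow> bool" where
  "mfps_summable F \<longleftrightarrow> (\<forall>m. finite {k. mfps_nth (F k) m \<noteq> 0})"

definition mfps_suminf ::
  "('k \<Rightarrow> ('a::comm_monoid_add, 'd::finite) mfps) \<Rightarrow> ('a, 'd) mfps" where
  "mfps_suminf F = Abs_mfps (\<lambda>m. \<Sum>k | mfps_nth (F k) m \<noteq> 0. mfps_nth (F k) m)"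

definition mfps_sums ::
  "('k \<Rightarrow> ('a::comm_monoid_add, 'd::finite) mfps) \<Rightarrow> ('a, 'd) mfps \<Rightarrow> bool" where
  "mfps_sums F S \<longleftrightarrow> mfps_summable F \<and> mfps_suminf F = S"

text \<open>
  Exponential and composition are meaningful only if the series that are substituted have zero
  constant terms; this makes the families below summable.
\<close>

definition mfps_exp ::
  "('a::{comm_ring_1,real_algebra_1}, 'd::finite) mfps \<Rightarrow> ('a, 'd) mfps" where
  "mfps_exp f = mfps_suminf (\<lambda>j::nat. (1 / fact j) *\<^sub>R f ^ j)"

definition mfps_compose ::
  "(real, 'd::finite) mfps \<Rightarrow> ('d \<Rightarrow> (real, 'd) mfps) \<Rightarrow> (real, 'd) mfps" where
  "mfps_compose f g = mfps_suminf (\<lambda>n. mfps_nth f n *\<^sub>R mpow g n)"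

text \<open>
  If \<open>f\<close> are the indicators of a delta system, they automatically have zero constant terms.
\<close>

definition compositional_inverse ::
  "('d::finite \<Rightarrow> (real, 'd) mfps) \<Rightarrow> ('d \<Rightarrow> (real, 'd) mfps) \<Rightarrow> bool" where
  "compositional_inverse f g \<longleftrightarrow>
     (\<forall>i. mfps_nth (g i) 0 = 0) \<and>
     (\<forall>i. mfps_compose (f i) g = mfps_X i) \<and>
     (\<forall>i. mfps_compose (g i) f = mfps_X i)"

text \<open>The series \<open>u\<^sub>1 g\<^sub>1(y) + \<dots> + u\<^sub>d g\<^sub>d(y)\<close> with coefficients in the ring of the \<open>u\<^sub>i\<close>.\<close>

definition mfps_dot ::
  "('d::finite \<Rightarrow> 'a::{comm_ring_1,real_algebra_1}) \<Rightarrow> ('d \<Rightarrow> (real, 'd) mfps) \<Rightarrow> ('a, 'd) mfps"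
  where
  "mfps_dot u g = (\<Sum>i\<in>UNIV. mfps_const (u i) * mfps_map of_real (g i))"


section \<open>Delta operators and their polynomial sequences\<close>

definition shift_invariant :: "('d::finite mpoly \<Rightarrow> 'd mpoly) \<Rightarrow> bool" where
  "shift_invariant T \<longleftrightarrow> linear T \<and> (\<forall>v p. T (mpoly_shift v p) = mpoly_shift v (T p))"

definition delta_system :: "('d::finite \<Rightarrow> 'd mpoly \<Rightarrow> 'd mpoly) \<Rightarrow> bool" where
  "delta_system D \<longleftrightarrow>
     (\<forall>i. shift_invariant (D i)) \<and>
     (\<forall>a :: 'd point. (\<Sum>j\<in>UNIV. (a $ j) *\<^sub>R mpoly_X j) \<noteq> (0 :: 'd mpoly) \<longrightarrow>
        (\<exists>c :: 'd point. (\<forall>i. D i (\<Sum>j\<in>UNIV. (a $ j) *\<^sub>R mpoly_X j) = of_real (c $ i)) \<and>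
                        (\<exists>i. c $ i \<noteq> 0)))"

text \<open>
  \<open>f\<close> is the indicator of \<open>T\<close>: \<open>T = \<Sum>\<^sub>n f\<^sub>n D\<^sup>n\<close> with \<open>D\<close> the partial derivatives.
  Only finitely many summands are nonzero for each \<open>p\<close>.
\<close>

definition is_indicator ::
  "('d::{finite,linorder} mpoly \<Rightarrow> 'd mpoly) \<Rightarrow> (real, 'd) mfps \<Rightarrow> bool" where
  "is_indicator T f \<longleftrightarrow> (\<forall>p. T p = Sum_any (\<lambda>n. mfps_nth f n *\<^sub>R op_mpow mpoly_deriv n p))"

text \<open>If \<open>n $ i = 0\<close>, subtraction truncates in the last equation, whose right-hand side is \<open>0\<close>.\<close>

definition basic_sequence ::
  "('d::finite \<Rightarrow> 'd mpoly \<Rightarrow> 'd mpoly) \<Rightarrow> ('d multiindex \<Rightarrow> 'd mpoly) \<Rightarrow> bool" where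
  "basic_sequence D p \<longleftrightarrow>
     (\<forall>n. mpoly_degree (p n) = mdeg n) \<and>
     p 0 = 1 \<and>
     (\<forall>n. mdeg n \<ge> 1 \<longrightarrow> mpoly_eval (p n) 0 = 0) \<and>
     (\<forall>i n. D i (p n) = real (n $ i) *\<^sub>R p (n - axis i 1))"

definition delta_space :: "('d::finite multiindex \<Rightarrow> 'd mpoly) \<Rightarrow> 'd multiindex \<Rightarrow> 'd mpoly set" where
  "delta_space p n = span {p k | k. k \<le> n}"

text \<open>
  \<open>t\<close> is the family of delta Goncarov polynomials for \<open>D\<close> and the nodes \<open>Z\<close>; here \<open>p\<close> is meant
  to be the basic sequence of \<open>D\<close>.
\<close>

definition delta_goncarov ::
  "('d::{finite,linorder} \<Rightarrow> 'd mpoly \<Rightarrow> 'd mpoly) \<Rightarrow> ('d multiindex \<Rightarrow> 'd mpoly) \<Rightarrow>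
   ('d multiindex \<Rightarrow> 'd point) \<Rightarrow> ('d multiindex \<Rightarrow> 'd mpoly) \<Rightarrow> bool" where
  "delta_goncarov D p Z t \<longleftrightarrow>
     (\<forall>n. t n \<in> delta_space p n) \<and>
     (\<forall>n k. k \<le> n \<longrightarrow>
        mpoly_eval (op_mpow D k (t n)) (Z k) = (if k = n then mfact n else 0))"

end

theory Submission
  imports Defs
begin

text \<open>
  Write \<open>P\<^sub>m = p\<^sub>m / m!\<close> and let \<open>E\<^sub>m\<close> be the coefficient of \<open>y\<^sup>m\<close> in \<open>exp(x \<cdot> g(y))\<close>. Since
  \<open>g\<^sub>i(f) = x\<^sub>i\<close>, the partial derivative \<open>\<partial>\<^sub>i\<close> is \<open>g\<^sub>i\<close> evaluated at the operators \<open>D\<close>; as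
  \<open>D\<close> acts on the generating function of \<open>P\<close> as multiplication by \<open>y\<close>, both families solve
  \<open>\<partial>\<^sub>i U = g\<^sub>i(y) U\<close> with \<open>U = 1\<close> at \<open>x = 0\<close>. This system has only one solution, because \<open>g\<^sub>i\<close> has no
  constant term, so \<open>P = E\<close>. Comparing coefficients, the theorem becomes
  \<open>P\<^sub>m = (\<Sum>k\<le>m. P\<^sub>m\<^sub>-\<^sub>k(z\<^sub>k) t\<^sub>k / k!)\<close>. Both sides lie in the span of \<open>p\<^sub>k\<close>, \<open>k \<le> m\<close>, and agree under
  all functionals \<open>r \<mapsto> (D\<^sup>k r)(z\<^sub>k)\<close>, \<open>k \<le> m\<close>, which determine an element of this span.
\<close>

declare One_nat_def [simp del]

section \<open>Multi-indices\<close>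

lemma mi_le_iff: "(a :: 'd::finite multiindex) \<le> b \<longleftrightarrow> (\<forall>i. a $ i \<le> b $ i)"
  by (simp add: less_eq_vec_def)

lemma mi_zero_le [simp]: "(0 :: 'd::finite multiindex) \<le> n"
  by (simp add: mi_le_iff)

lemma mi_diff_zero [simp]: "(n :: 'd::finite multiindex) - 0 = n"
  by (simp add: vec_eq_iff)

lemma mi_le_add_diff:
  fixes a b :: "'d::finite multiindex"
  shows "a \<le> b \<Longrightarrow> a + (b - a) = b" "a \<le> b \<Longrightarrow> b - a + a = b"
  by (simp_all add: mi_le_iff vec_eq_iff)

lemma mi_diff_diff: "(n :: 'd::finite multiindex) - a - b = n - (a + b)"
  by (simp add: vec_eq_iff)

lemma mi_le_add [simp]: "(a :: 'd::finite multiindex) \<le> a + b"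
  by (simp add: mi_le_iff)

lemma mi_diff_diff_cancel: "k \<le> n \<Longrightarrow> n - (n - k) = (k :: 'd::finite multiindex)"
  by (simp add: mi_le_iff vec_eq_iff)

lemma mi_add_le: "a \<le> n \<Longrightarrow> c \<le> n - a \<Longrightarrow> a + c \<le> (n :: 'd::finite multiindex)"
  unfolding mi_le_iff vector_minus_component vector_add_component
  by (metis le_diff_conv2 add.commute)

lemma mi_diff_mono: "e \<le> n \<Longrightarrow> e - a \<le> n - (a :: 'd::finite multiindex)"
  by (simp add: mi_le_iff diff_le_mono)

lemma mi_diff_le [simp]: "(a :: 'd::finite multiindex) - b \<le> a"
  by (simp add: mi_le_iff)

lemma finite_mi_atMost [simp]: "finite {..n :: 'd::finite multiindex}"
  by (rule finite_multiindex_atMost)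

lemma mdeg_add: "mdeg (a + b) = mdeg a + mdeg b"
  by (simp add: mdeg_def sum.distrib)

lemma mdeg_eq_0_iff [simp]: "mdeg n = 0 \<longleftrightarrow> n = 0"
  by (simp add: mdeg_def vec_eq_iff)

lemma mdeg_mono: "a \<le> b \<Longrightarrow> mdeg a \<le> mdeg b"
  by (simp add: mdeg_def mi_le_iff sum_mono)

lemma mdeg_diff: "a \<le> b \<Longrightarrow> mdeg b = mdeg a + mdeg (b - a)"
  by (metis mdeg_add mi_le_add_diff(1))

lemma mdeg_strict_mono: "a \<le> b \<Longrightarrow> a \<noteq> b \<Longrightarrow> mdeg a < mdeg b"
  by (metis add.right_neutral add_cancel_right_right less_add_same_cancel1 mdeg_diff mdeg_eq_0_iff
      mi_le_add_diff(1) not_gr_zero)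

lemma finite_mdeg_le: "finite {n :: 'd::finite multiindex. mdeg n \<le> N}"
proof (rule finite_subset)
  show "{n :: 'd multiindex. mdeg n \<le> N} \<subseteq> {..(\<chi> i. N)}"
  proof clarsimp
    fix n :: "'d multiindex" assume "mdeg n \<le> N"
    moreover have "n $ i \<le> mdeg n" for i
      unfolding mdeg_def by (rule member_le_sum) auto
    ultimately show "n \<le> (\<chi> i. N)"
      by (auto simp: mi_le_iff intro: order_trans)
  qed
qed simp

lemma mfact_nonzero [simp]: "mfact n \<noteq> 0"
  by (simp add: mfact_def)

lemma mfact_zero [simp]: "mfact 0 = 1"
  by (simp add: mfact_def)

lemma mi_induct [case_names less]:
  fixes n :: "'d::finite multiindex"
  assumes "\<And>n. (\<And>m. m \<le> n \<Longrightarrow> m \<noteq> n \<Longrightarrow> P m) \<Longrightarrow> P n"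
  shows "P n"
  by (induction n rule: measure_induct_rule[of mdeg]) (use assms mdeg_strict_mono in blast)

text \<open>With \<open>e = a + c\<close>, both sides run over the pairs with
  \<open>a + c \<le> n\<close>. It serves to turn composed operators into a Cauchy product.\<close>

lemma sum_mi_nested:
  fixes F :: "'d::finite multiindex \<Rightarrow> 'd multiindex \<Rightarrow> 'a::comm_monoid_add"
  shows "(\<Sum>a\<le>n. \<Sum>c\<le>n - a. F a c) = (\<Sum>e\<le>n. \<Sum>a\<le>e. F a (e - a))"
proof -
  have "(\<Sum>a\<le>n. \<Sum>c\<le>n - a. F a c) = (\<Sum>(a, c)\<in>(SIGMA a:{..n}. {..n - a}). F a c)"
    by (rule sum.Sigma) auto
  also have "\<dots> = (\<Sum>(e, a)\<in>(SIGMA e:{..n}. {..e}). F a (e - a))"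
    by (rule sum.reindex_bij_witness[of _ "\<lambda>(e, a). (a, e - a)" "\<lambda>(a, c). (a + c, a)"])
       (auto simp: mi_add_le mi_diff_mono mi_le_add_diff intro: order_trans)
  also have "\<dots> = (\<Sum>e\<le>n. \<Sum>a\<le>e. F a (e - a))"
    by (rule sum.Sigma[symmetric]) auto
  finally show ?thesis .
qed

lemma sum_mi_flip:
  fixes F :: "'d::finite multiindex \<Rightarrow> 'd multiindex \<Rightarrow> 'a::comm_monoid_add"
  shows "(\<Sum>k\<le>n. F k (n - k)) = (\<Sum>k\<le>n. F (n - k) k)"
  by (rule sum.reindex_bij_witness[of _ "\<lambda>k. n - k" "\<lambda>k. n - k"])
     (auto simp: mi_diff_diff_cancel)

text \<open>The factor that \<open>k\<close>-fold differentiation produces on \<open>x\<^sup>n\<close>.\<close>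

definition mffact :: "'d::finite multiindex \<Rightarrow> 'd multiindex \<Rightarrow> real" where
  "mffact n k = (if k \<le> n then mfact n / mfact (n - k) else 0)"

text \<open>If \<open>k \<le> n\<close> fails, it fails in some component, whose factor makes the
  product vanish.\<close>

lemma mffact_eq_prod:
  "mffact n k = (\<Prod>i\<in>UNIV. if k $ i \<le> n $ i then fact (n $ i) / fact (n $ i - k $ i) else 0)"
proof (cases "k \<le> n")
  case True
  then show ?thesis
    by (auto simp: mffact_def mfact_def mi_le_iff prod_dividef)
next
  case False
  then obtain i where "\<not> k $ i \<le> n $ i" by (auto simp: mi_le_iff)
  then have "(\<Prod>i\<in>UNIV. if k $ i \<le> n $ i then fact (n $ i) / fact (n $ i - k $ i) else 0) = (0::real)"
    by (intro prod_zero) auto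
  with False show ?thesis by (simp add: mffact_def)
qed

lemma mffact_zero [simp]: "mffact n 0 = 1"
  by (simp add: mffact_def)

lemma mffact_axis: "mffact n (axis i 1) = real (n $ i)"
proof -
  have "mffact n (axis i 1) = (\<Prod>j\<in>UNIV. if j = i then real (n $ i) else 1)"
    unfolding mffact_eq_prod
    by (rule prod.cong) (auto simp: axis_def Suc_le_eq fact_reduce)
  also have "\<dots> = real (n $ i)" by simp
  finally show ?thesis .
qed

text \<open>The factorial of \<open>n - a\<close> cancels between the two factors. If
  \<open>a \<le> n\<close> fails, \<open>n - a\<close> is truncated, but both sides are 0.\<close>

lemma mffact_add: "mffact n (a + b) = mffact n a * mffact (n - a) b"
proof (cases "a \<le> n")
  case True
  then have "b \<le> n - a \<longleftrightarrow> a + b \<le> n"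
    by (auto simp: mi_le_iff le_diff_conv2 add.commute)
  with True show ?thesis
    by (simp add: mffact_def mi_diff_diff)
next
  case False
  moreover have "a + b \<le> n \<Longrightarrow> a \<le> n"
    using mi_le_add order_trans by blast
  ultimately show ?thesis
    by (auto simp: mffact_def)
qed

lemma mi_axis_le_iff: "axis i 1 \<le> (n :: 'd::finite multiindex) \<longleftrightarrow> n $ i \<noteq> 0"
  by (auto simp: mi_le_iff axis_def)

section \<open>Multivariate power series\<close>

lemmas mfps_ring_defs = zero_mfps_def one_mfps_def plus_mfps_def minus_mfps_def uminus_mfps_def

lemma mfps_nth_zero [simp]: "mfps_nth 0 n = 0"
  and mfps_nth_one: "mfps_nth 1 n = (if n = 0 then 1 else 0)"
  and mfps_nth_add [simp]: "mfps_nth (f + g) n = mfps_nth f n + mfps_nth g n"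
  and mfps_nth_mult: "mfps_nth (f * g) n = (\<Sum>k\<le>n. mfps_nth f k * mfps_nth g (n - k))"
  by (simp_all add: mfps_ring_defs times_mfps_def)

lemma mfps_nth_scaleR [simp]: "mfps_nth (r *\<^sub>R f) n = r *\<^sub>R mfps_nth f n"
  by (simp add: scaleR_mfps_def)

lemma mfps_nth_sum [simp]: "mfps_nth (\<Sum>a\<in>A. F a) n = (\<Sum>a\<in>A. mfps_nth (F a) n)"
  by (induction A rule: infinite_finite_induct) auto

lemma mfps_nth_map [simp]: "mfps_nth (mfps_map h f) n = h (mfps_nth f n)"
  by (simp add: mfps_map_def)

lemma mfps_nth_const_mult [simp]: "mfps_nth (mfps_const c * f) n = c * mfps_nth f n"
proof -
  have "(\<Sum>k\<le>n. mfps_nth (mfps_const c) k * mfps_nth f (n - k))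
      = (\<Sum>k\<in>{0}. mfps_nth (mfps_const c) k * mfps_nth f (n - k))"
    by (rule sum.mono_neutral_right) (auto simp: mfps_const_def)
  then show ?thesis by (simp add: mfps_nth_mult mfps_const_def)
qed

lemma mfps_nth_dot:
  "mfps_nth (mfps_dot u g) n = (\<Sum>i\<in>UNIV. mfps_nth (g i) n *\<^sub>R u i)"
  by (simp add: mfps_dot_def scaleR_conv_of_real mult.commute)

text \<open>Multiplication by this monomial merely shifts coefficients, which makes the powers of
  \<open>mfps_X\<close> in the theorem computable.\<close>

definition mfps_monom :: "'d::finite multiindex \<Rightarrow> ('a::comm_ring_1, 'd) mfps" where
  "mfps_monom a = Abs_mfps (\<lambda>n. if n = a then 1 else 0)"

lemma mfps_nth_monom_mult:
  "mfps_nth (mfps_monom a * f) n = (if a \<le> n then mfps_nth f (n - a) else 0)"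
proof -
  have "mfps_nth (mfps_monom a * f) n = (\<Sum>k\<le>n. if k = a then mfps_nth f (n - k) else 0)"
    unfolding mfps_nth_mult by (rule sum.cong) (auto simp: mfps_monom_def)
  then show ?thesis by simp
qed

lemma mfps_monom_mult: "mfps_monom a * mfps_monom b = mfps_monom (a + b)"
  by (rule mfps_eqI, subst mfps_nth_monom_mult) (auto simp: mfps_monom_def mi_le_add_diff)

lemma mfps_monom_zero: "mfps_monom 0 = 1"
  by (rule mfps_eqI) (simp add: mfps_monom_def mfps_nth_one)

lemma mfps_X_eq_monom: "mfps_X i = mfps_monom (axis i 1)"
  by (simp add: mfps_X_def mfps_monom_def)

lemma mfps_X_power:
  fixes i :: "'a::finite"
  shows "mfps_X i ^ r = mfps_monom (axis i r)"
proof (induction r)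
  case 0
  have "axis i 0 = (0 :: 'a multiindex)" by (simp add: axis_def vec_eq_iff)
  then show ?case by (simp only: power_0 mfps_monom_zero)
next
  case (Suc r)
  have "axis i 1 + axis i r = axis i (Suc r)" by (simp add: axis_def vec_eq_iff)
  with Suc show ?case by (simp add: mfps_X_eq_monom mfps_monom_mult)
qed

lemma mpow_mfps_X:
  fixes k :: "'d::finite multiindex"
  shows "mpow mfps_X k = (mfps_monom k :: ('a::comm_ring_1, 'd) mfps)"
proof -
  have "(\<Prod>i\<in>A. mfps_X i ^ (k $ i)) = (mfps_monom (\<Sum>i\<in>A. axis i (k $ i)) :: ('a, 'd) mfps)" for A
    by (induction A rule: infinite_finite_induct)
       (auto simp: mfps_monom_zero mfps_X_power mfps_monom_mult)
  moreover have "(\<Sum>i\<in>UNIV. axis i (k $ i)) = k"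
    by (simp add: vec_eq_iff axis_def sum_component)
  ultimately show ?thesis by (simp add: mpow_def)
qed

text \<open>A lower bound on the order instead of the order itself: the zero series needs no special
  case, and the bounds simply add under products.\<close>

definition mfps_order_ge :: "('a::comm_ring_1, 'd::finite) mfps \<Rightarrow> nat \<Rightarrow> bool" where
  "mfps_order_ge f N \<longleftrightarrow> (\<forall>n. mdeg n < N \<longrightarrow> mfps_nth f n = 0)"

lemma mfps_order_ge_mult:
  assumes "mfps_order_ge f M" "mfps_order_ge g N"
  shows "mfps_order_ge (f * g) (M + N)"
  unfolding mfps_order_ge_def
proof (intro allI impI)
  fix n :: "'b multiindex" assume n: "mdeg n < M + N"
  show "mfps_nth (f * g) n = 0"
    unfolding mfps_nth_mult
  proof (rule sum.neutral, rule ballI)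
    fix k assume "k \<in> {..n}"
    then have "mdeg n = mdeg k + mdeg (n - k)" by (intro mdeg_diff) simp
    with n have "mdeg k < M \<or> mdeg (n - k) < N" by linarith
    with assms show "mfps_nth f k * mfps_nth g (n - k) = 0"
      by (auto simp: mfps_order_ge_def)
  qed
qed

lemma mfps_order_ge_power: "mfps_nth f 0 = 0 \<Longrightarrow> mfps_order_ge (f ^ j) j"
proof (induction j)
  case (Suc j)
  have "mfps_order_ge f 1" using Suc by (simp add: mfps_order_ge_def)
  from mfps_order_ge_mult[OF this Suc.IH[OF Suc.prems]] show ?case
    by (simp only: power_Suc plus_1_eq_Suc)
qed (simp add: mfps_order_ge_def)

lemma mfps_order_ge_mpow:
  assumes "\<And>i. mfps_nth (f i) 0 = 0"
  shows "mfps_order_ge (mpow f k) (mdeg k)"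
proof -
  have "mfps_order_ge (\<Prod>i\<in>A. f i ^ (k $ i)) (\<Sum>i\<in>A. k $ i)" for A
  proof (induction A rule: infinite_finite_induct)
    case (insert i A)
    with mfps_order_ge_mult[OF mfps_order_ge_power[of "f i" "k $ i"] insert.IH] assms
    show ?case by simp
  qed (simp_all add: mfps_order_ge_def)
  then show ?thesis by (simp add: mpow_def mdeg_def)
qed

text \<open>Since \<open>f ^ j\<close> has order at least \<open>j\<close>, the terms beyond
  \<open>mdeg n\<close> vanish. The free bound \<open>N\<close> lets several coefficients share one
  summation range.\<close>

lemma mfps_nth_exp:
  assumes "mfps_nth f 0 = 0" and "mdeg n \<le> N"
  shows "mfps_nth (mfps_exp f) n = (\<Sum>j\<le>N. (1 / fact j) *\<^sub>R mfps_nth (f ^ j) n)"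
proof -
  have "mfps_nth (f ^ j) n = 0" if "j > N" for j
    using mfps_order_ge_power[OF assms(1), of j] assms(2) that by (auto simp: mfps_order_ge_def)
  then have "{j. (1 / fact j) *\<^sub>R mfps_nth (f ^ j) n \<noteq> 0} \<subseteq> {..N}"
    by (auto simp flip: not_less)
  then show ?thesis
    unfolding mfps_exp_def mfps_suminf_def
    by (auto intro!: sum.mono_neutral_left)
qed

section \<open>Linear maps on polynomials\<close>

lemma lookup_scaleR [simp]: "Poly_Mapping.lookup (r *\<^sub>R p) k = r *\<^sub>R Poly_Mapping.lookup p k"
  by (simp add: scaleR_poly_mapping_def)

abbreviation mpoly_mon :: "'d::finite multiindex \<Rightarrow> 'd mpoly" where
  "mpoly_mon n \<equiv> Poly_Mapping.single n 1"

lemma single_eq_scaleR: "Poly_Mapping.single n c = c *\<^sub>R (Poly_Mapping.single n 1)" for c :: real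
  by (rule poly_mapping_eqI) (simp add: lookup_single when_def)

lemma mono_mult: "mpoly_mon a * mpoly_mon b = mpoly_mon (a + b)"
  by (simp add: mult_single)

definition mpoly_linear :: "('d::finite multiindex \<Rightarrow> 'v) \<Rightarrow> 'd mpoly \<Rightarrow> 'v::real_vector" where
  "mpoly_linear h p = (\<Sum>n\<in>Poly_Mapping.keys p. Poly_Mapping.lookup p n *\<^sub>R h n)"

lemma mpoly_linear_superset:
  assumes "finite A" "Poly_Mapping.keys p \<subseteq> A"
  shows "mpoly_linear h p = (\<Sum>n\<in>A. Poly_Mapping.lookup p n *\<^sub>R h n)"
  unfolding mpoly_linear_def using assms
  by (intro sum.mono_neutral_left) (auto simp: in_keys_iff)

lemma linear_mpoly_linear: "linear (mpoly_linear h)"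
proof (rule linearI)
  fix p q :: "'a mpoly" and r :: real
  have "Poly_Mapping.keys (p + q) \<subseteq> Poly_Mapping.keys p \<union> Poly_Mapping.keys q"
    by (rule Poly_Mapping.keys_add)
  then show "mpoly_linear h (p + q) = mpoly_linear h p + mpoly_linear h q"
    by (simp add: mpoly_linear_superset[of "Poly_Mapping.keys p \<union> Poly_Mapping.keys q"]
        lookup_add scaleR_add_left sum.distrib)
  have "Poly_Mapping.keys (r *\<^sub>R p) \<subseteq> Poly_Mapping.keys p"
    by (auto simp: in_keys_iff)
  then show "mpoly_linear h (r *\<^sub>R p) = r *\<^sub>R mpoly_linear h p"
    by (simp add: mpoly_linear_superset[of "Poly_Mapping.keys p"] scaleR_sum_right)
qed

lemma mpoly_linear_mono [simp]: "mpoly_linear h (mpoly_mon n) = h n"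
  by (simp add: mpoly_linear_def)

lemma mpoly_expand: "mpoly_linear mpoly_mon p = p"
proof (rule poly_mapping_eqI)
  fix k
  have "Poly_Mapping.lookup (mpoly_linear mpoly_mon p) k
      = (\<Sum>n\<in>Poly_Mapping.keys p. if n = k then Poly_Mapping.lookup p n else 0)"
    unfolding mpoly_linear_def lookup_sum
    by (rule sum.cong) (auto simp: lookup_single when_def)
  then show "Poly_Mapping.lookup (mpoly_linear mpoly_mon p) k = Poly_Mapping.lookup p k"
    by (auto simp: in_keys_iff)
qed

text \<open>The monomials span by \<open>mpoly_expand\<close>; later identities between linear
  operators are thus checked on monomials only.\<close>

lemma mpoly_linear_eqI:
  assumes "linear S" "linear T" "\<And>n. S (mpoly_mon n) = T (mpoly_mon n)"
  shows "S p = T p"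
proof -
  have "S (mpoly_linear mpoly_mon p) = T (mpoly_linear mpoly_mon p)"
    using assms
    by (simp add: mpoly_linear_def linear_sum linear_scale)
  then show ?thesis by (simp add: mpoly_expand)
qed

section \<open>Partial derivatives of polynomials\<close>

lemma mpoly_deriv_eq_linear:
  "mpoly_deriv i = mpoly_linear (\<lambda>n. real (n $ i) *\<^sub>R mpoly_mon (n - axis i 1))"
  by (rule ext) (simp add: mpoly_deriv_def mpoly_linear_def single_eq_scaleR[of _ "_ * _"] mult.commute)

lemma linear_mpoly_deriv: "linear (mpoly_deriv i)"
  by (simp add: mpoly_deriv_eq_linear linear_mpoly_linear)

lemma mpoly_deriv_mono: "mpoly_deriv i (mpoly_mon n) = real (n $ i) *\<^sub>R mpoly_mon (n - axis i 1)"
  by (simp add: mpoly_deriv_eq_linear)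

lemma mpoly_deriv_X: "mpoly_deriv i (mpoly_X j) = (if i = j then 1 else 0)"
  by (simp add: mpoly_X_def mpoly_deriv_mono axis_def)

lemma mpoly_deriv_mult: "mpoly_deriv i (p * q) = mpoly_deriv i p * q + p * mpoly_deriv i q"
proof -
  note ls = linear_add[OF linear_mpoly_deriv] linear_scale[OF linear_mpoly_deriv]
  have mono: "mpoly_deriv i (mpoly_mon a * mpoly_mon b) = mpoly_deriv i (mpoly_mon a) * mpoly_mon b + mpoly_mon a * mpoly_deriv i (mpoly_mon b)"
    for a b
  proof -
    \<comment> \<open>Subtraction truncates where an exponent is 0, but the coefficient of that term
      is then 0 as well.\<close>
    have "a - axis i 1 + b = a + b - axis i 1" if "a $ i \<noteq> 0"
      using that by (auto simp: vec_eq_iff axis_def)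
    moreover have "a + (b - axis i 1) = a + b - axis i 1" if "b $ i \<noteq> 0"
      using that by (auto simp: vec_eq_iff axis_def)
    ultimately show ?thesis
      by (cases "a $ i = 0"; cases "b $ i = 0")
         (simp_all add: mono_mult mpoly_deriv_mono scaleR_add_left)
  qed
  have "mpoly_deriv i (mpoly_mon a * q) = mpoly_deriv i (mpoly_mon a) * q + mpoly_mon a * mpoly_deriv i q" for a
    by (rule mpoly_linear_eqI[where p = q and S = "\<lambda>q. mpoly_deriv i (mpoly_mon a * q)" and
          T = "\<lambda>q. mpoly_deriv i (mpoly_mon a) * q + mpoly_mon a * mpoly_deriv i q"])
       (auto intro!: linearI simp: ls algebra_simps mono)
  then show ?thesis
    by (intro mpoly_linear_eqI[where p = p and S = "\<lambda>p. mpoly_deriv i (p * q)" and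
          T = "\<lambda>p. mpoly_deriv i p * q + p * mpoly_deriv i q"])
       (auto intro!: linearI simp: ls algebra_simps)
qed

text \<open>Going up from \<open>n\<close> to \<open>n + axis i 1\<close> avoids truncated
  subtraction and lets the coefficients of \<open>p\<close> be read off from its
  derivatives.\<close>

lemma lookup_mpoly_deriv:
  "Poly_Mapping.lookup (mpoly_deriv i p) n
     = real (Suc (n $ i)) * Poly_Mapping.lookup p (n + axis i 1)"
proof (rule mpoly_linear_eqI[where p = p])
  show "linear (\<lambda>p. Poly_Mapping.lookup (mpoly_deriv i p) n)"
    using linear_mpoly_deriv[of i]
    by (intro linearI) (simp_all add: linear_add linear_scale lookup_add)
  show "linear (\<lambda>p. real (Suc (n $ i)) * Poly_Mapping.lookup p (n + axis i 1))"
    by (intro linearI) (simp_all add: lookup_add algebra_simps)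
  fix b
  have "b - axis i 1 = n \<longleftrightarrow> b = n + axis i 1" if "b $ i \<noteq> 0"
    using that by (auto simp: vec_eq_iff axis_def)
  moreover have "b \<noteq> n + axis i 1" if "b $ i = 0"
    using that by (auto simp: vec_eq_iff axis_def)
  ultimately show "Poly_Mapping.lookup (mpoly_deriv i (mpoly_mon b)) n
      = real (Suc (n $ i)) * Poly_Mapping.lookup (mpoly_mon b) (n + axis i 1)"
    by (cases "b $ i = 0") (auto simp: mpoly_deriv_mono lookup_single when_def)
qed

text \<open>Each coefficient at \<open>n \<noteq> 0\<close> reappears, with a nonzero factor, in the
  derivative along some \<open>i\<close> with \<open>n $ i \<noteq> 0\<close>.\<close>

lemma mpoly_constI:
  assumes "\<And>i. mpoly_deriv i p = 0"
  shows "p = of_real (Poly_Mapping.lookup p 0)"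
proof -
  have "Poly_Mapping.lookup p n = 0" if n: "n \<noteq> 0" for n
  proof -
    obtain i where "n $ i \<noteq> 0" using n by (auto simp: vec_eq_iff)
    then have "n - axis i 1 + axis i 1 = n" by (intro mi_le_add_diff) (simp add: mi_axis_le_iff)
    with lookup_mpoly_deriv[of i p "n - axis i 1"] assms show ?thesis by simp
  qed
  then show ?thesis
    by (intro poly_mapping_eqI) (auto simp: of_real_def lookup_one when_def)
qed

section \<open>Substitution into polynomials\<close>

lemma mpow_add: "mpow s (a + b) = mpow s a * mpow s b"
  by (simp add: mpow_def power_add prod.distrib)

lemma mpow_axis [simp]: "mpow s (axis i 1) = s i"
proof -
  have "mpow s (axis i 1) = (\<Prod>j\<in>UNIV. if j = i then s i else 1)"
    unfolding mpow_def by (rule prod.cong) (auto simp: axis_def)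
  then show ?thesis by simp
qed

lemma mpoly_subst_eq_linear: "mpoly_subst s = mpoly_linear (mpow s)"
  by (rule ext) (simp add: mpoly_subst_def mpoly_linear_def scaleR_conv_of_real)

lemma linear_mpoly_subst: "linear (mpoly_subst s)"
  by (simp add: mpoly_subst_eq_linear linear_mpoly_linear)

lemma mpoly_subst_mono: "mpoly_subst s (mpoly_mon n) = mpow s n"
  by (simp add: mpoly_subst_eq_linear)

lemma mpoly_subst_X [simp]: "mpoly_subst s (mpoly_X i) = s i"
  by (simp add: mpoly_X_def mpoly_subst_mono)

lemma mpoly_subst_mult: "mpoly_subst s (p * q) = mpoly_subst s p * mpoly_subst s q"
proof -
  note ls = linear_add[OF linear_mpoly_subst] linear_scale[OF linear_mpoly_subst]
  have mono: "mpoly_subst s (mpoly_mon a * mpoly_mon b) = mpoly_subst s (mpoly_mon a) * mpoly_subst s (mpoly_mon b)" for a b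
    by (simp add: mono_mult mpoly_subst_mono mpow_add)
  have "mpoly_subst s (mpoly_mon a * q) = mpoly_subst s (mpoly_mon a) * mpoly_subst s q" for a
    by (rule mpoly_linear_eqI[where p = q and S = "\<lambda>q. mpoly_subst s (mpoly_mon a * q)" and
          T = "\<lambda>q. mpoly_subst s (mpoly_mon a) * mpoly_subst s q"])
       (auto intro!: linearI simp: ls algebra_simps mono)
  then show ?thesis
    by (intro mpoly_linear_eqI[where p = p and S = "\<lambda>p. mpoly_subst s (p * q)" and
          T = "\<lambda>p. mpoly_subst s p * mpoly_subst s q"])
       (auto intro!: linearI simp: ls algebra_simps)
qed

lemma mpoly_subst_one [simp]: "mpoly_subst s 1 = 1"
  using mpoly_subst_mono[of s 0] by (simp add: mpow_def)

lemma mpoly_subst_of_real [simp]: "mpoly_subst s (of_real c) = of_real c"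
  by (simp add: of_real_def linear_scale[OF linear_mpoly_subst])

text \<open>Links substitution of the constants \<open>of_real (Z k $ i)\<close> in the theorem with
  real evaluation.\<close>

lemma mpoly_subst_const: "mpoly_subst (\<lambda>i. of_real (v $ i)) q = of_real (mpoly_eval q v)"
  by (simp add: mpoly_eval_def mpoly_subst_def mpow_def)

section \<open>Operators with a given indicator\<close>

lemma linear_funpow: "linear T \<Longrightarrow> linear (T ^^ r)" for T :: "'v::real_vector \<Rightarrow> 'v"
  by (induction r) (auto simp: id_def[symmetric] linear_id intro: linear_compose)

lemma linear_op_mpow:
  fixes D :: "'d::{finite,linorder} \<Rightarrow> 'v::real_vector \<Rightarrow> 'v"
  assumes "\<And>i. linear (D i)"
  shows "linear (op_mpow D k)"
proof -
  have "linear (foldr (\<lambda>i T. (D i ^^ (k $ i)) \<circ> T) xs id)" for xs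
  proof (induction xs)
    case (Cons i xs)
    then show ?case
      using linear_compose[OF Cons linear_funpow[OF assms]] by (simp add: comp_def)
  qed (simp add: linear_ident)
  then show ?thesis by (simp add: op_mpow_def)
qed

text \<open>The family \<open>q\<close> is left abstract: it will be the monomials under partial
  derivatives and the basic sequence under \<open>D\<close>.\<close>

lemma op_mpow_lowering:
  fixes D :: "'d::{finite,linorder} \<Rightarrow> 'v::real_vector \<Rightarrow> 'v"
  assumes lin: "\<And>i. linear (D i)"
    and D: "\<And>i n. D i (q n) = real (n $ i) *\<^sub>R q (n - axis i 1)"
  shows "op_mpow D k (q n) = mffact n k *\<^sub>R q (n - k)"
proof -
  have pow: "(D i ^^ r) (q n) = mffact n (axis i r) *\<^sub>R q (n - axis i r)" for i r n
  proof (induction r)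
    case 0
    have "axis i 0 = (0 :: 'd multiindex)" by (simp add: axis_def vec_eq_iff)
    then show ?case by (simp only: funpow.simps id_apply mffact_zero mi_diff_zero scaleR_one)
  next
    case (Suc r)
    have "axis i (Suc r) = axis i r + (axis i 1 :: 'd multiindex)"
      by (simp add: axis_def vec_eq_iff)
    with Suc show ?case
      by (simp add: linear_scale[OF lin] D mffact_add mffact_axis mi_diff_diff)
  qed
  \<comment> \<open>The list \<open>xs\<close> is arbitrary so that induction applies;
    \<open>mffact_add\<close> merges the factors of successive operators.\<close>
  have "foldr (\<lambda>i T. (D i ^^ (k $ i)) \<circ> T) xs id (q n)
      = mffact n (\<Sum>i\<leftarrow>xs. axis i (k $ i)) *\<^sub>R q (n - (\<Sum>i\<leftarrow>xs. axis i (k $ i)))" for xs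
  proof (induction xs)
    case (Cons i xs)
    then show ?case
      by (simp add: linear_scale[OF linear_funpow[OF lin]] pow mi_diff_diff
          mffact_add[of n "\<Sum>i\<leftarrow>xs. axis i (k $ i)", symmetric] add.commute)
  qed simp
  moreover have "(\<Sum>i\<leftarrow>sorted_list_of_set UNIV. axis i (k $ i)) = k"
    by (simp add: sum_list_distinct_conv_sum_set vec_eq_iff axis_def sum_component)
  ultimately show ?thesis by (simp add: op_mpow_def)
qed

text \<open>Prescribing the values on monomials avoids the infinite sum over partial derivatives.\<close>

definition indicator_op :: "(real, 'd::finite) mfps \<Rightarrow> 'd mpoly \<Rightarrow> 'd mpoly" where
  "indicator_op h = mpoly_linear
     (\<lambda>b. \<Sum>a\<le>b. (mfps_nth h a * mffact b a) *\<^sub>R mpoly_mon (b - a))"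

lemma linear_indicator_op: "linear (indicator_op h)"
  by (simp add: indicator_op_def linear_mpoly_linear)

lemma indicator_op_mon:
  "indicator_op h (mpoly_mon b) = (\<Sum>a\<le>b. (mfps_nth h a * mffact b a) *\<^sub>R mpoly_mon (b - a))"
  by (simp add: indicator_op_def)

text \<open>\<open>mffact_add\<close> merges the two differentiations, and collecting the terms with
  \<open>e = a + c\<close> produces the Cauchy product of \<open>h'\<close> and
  \<open>h\<close>.\<close>

lemma indicator_op_mult: "indicator_op (h * h') p = indicator_op h (indicator_op h' p)"
proof (rule mpoly_linear_eqI[where p = p])
  show "linear (indicator_op (h * h'))" by (rule linear_indicator_op)
  show "linear (\<lambda>p. indicator_op h (indicator_op h' p))"
    using linear_compose[OF linear_indicator_op linear_indicator_op] by (simp add: comp_def)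
  fix b
  let ?m = "mpoly_mon" and ?h = "mfps_nth h" and ?k = "mfps_nth h'"
  have "indicator_op h (indicator_op h' (?m b))
      = (\<Sum>a\<le>b. \<Sum>c\<le>b - a. (?k a * ?h c * mffact b (a + c)) *\<^sub>R ?m (b - (a + c)))"
    by (simp add: indicator_op_mon linear_sum[OF linear_indicator_op]
        linear_scale[OF linear_indicator_op] scaleR_sum_right mffact_add mi_diff_diff mult_ac)
  also have "\<dots> = (\<Sum>e\<le>b. \<Sum>a\<le>e. (?k a * ?h (e - a) * mffact b (a + (e - a))) *\<^sub>R ?m (b - (a + (e - a))))"
    by (rule sum_mi_nested)
  also have "\<dots> = (\<Sum>e\<le>b. \<Sum>a\<le>e. (?k a * ?h (e - a) * mffact b e) *\<^sub>R ?m (b - e))"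
    by (intro sum.cong refl) (simp add: mi_le_add_diff)
  also have "\<dots> = (\<Sum>e\<le>b. (mfps_nth (h' * h) e * mffact b e) *\<^sub>R ?m (b - e))"
    by (simp add: mfps_nth_mult scaleR_sum_left sum_distrib_right)
  finally show "indicator_op (h * h') (?m b) = indicator_op h (indicator_op h' (?m b))"
    by (simp add: indicator_op_mon mult.commute[of h h'])
qed

lemma indicator_op_monom:
  "indicator_op (mfps_monom k) (mpoly_mon b) = mffact b k *\<^sub>R mpoly_mon (b - k)"
proof -
  have "indicator_op (mfps_monom k) (mpoly_mon b)
      = (\<Sum>a\<le>b. if a = k then mffact b k *\<^sub>R mpoly_mon (b - k) else 0)"
    unfolding indicator_op_mon by (rule sum.cong) (auto simp: mfps_monom_def)
  then show ?thesis by (simp add: mffact_def)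
qed

lemma indicator_op_one [simp]: "indicator_op 1 p = p"
  by (rule mpoly_linear_eqI[where p = p])
     (auto simp: linear_indicator_op linear_ident indicator_op_monom simp flip: mfps_monom_zero)

lemma indicator_op_X: "indicator_op (mfps_X i) p = mpoly_deriv i p"
  by (rule mpoly_linear_eqI[where p = p])
     (auto simp: linear_indicator_op linear_mpoly_deriv indicator_op_monom mfps_X_eq_monom
        mpoly_deriv_mono mffact_axis)

text \<open>A derivative of index \<open>a\<close> annihilates a monomial of exponent
  \<open>b\<close> unless \<open>a \<le> b\<close>, so only finitely many coefficients of
  \<open>h\<close> act on \<open>p\<close>.\<close>

lemma indicator_op_cong:
  assumes "\<And>b a. b \<in> Poly_Mapping.keys p \<Longrightarrow> a \<le> b \<Longrightarrow> mfps_nth h a = mfps_nth h' a"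
  shows "indicator_op h p = indicator_op h' p"
  using assms by (auto simp: indicator_op_def mpoly_linear_def intro!: sum.cong)

lemma indicator_op_add: "indicator_op (h + h') p = indicator_op h p + indicator_op h' p"
  by (simp add: indicator_op_def mpoly_linear_def algebra_simps sum.distrib)

lemma indicator_op_zero [simp]: "indicator_op 0 p = 0"
  by (simp add: indicator_op_def mpoly_linear_def)

lemma indicator_op_scaleR: "indicator_op (c *\<^sub>R h) p = c *\<^sub>R indicator_op h p"
  by (simp add: indicator_op_def mpoly_linear_def scaleR_sum_right mult_ac)

lemma indicator_op_sum: "indicator_op (\<Sum>k\<in>K. F k) p = (\<Sum>k\<in>K. indicator_op (F k) p)"
  by (induction K rule: infinite_finite_induct) (auto simp: indicator_op_add)

text \<open>Only finitely many coefficients act on \<open>p\<close>, and summability leaves finitely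
  many members touching them. Allowing every larger \<open>L\<close> lets the summation range be
  chosen later.\<close>

lemma indicator_op_suminf:
  assumes "mfps_summable F"
  obtains K where "finite K"
    and "\<And>L. finite L \<Longrightarrow> K \<subseteq> L \<Longrightarrow> indicator_op (mfps_suminf F) p = (\<Sum>k\<in>L. indicator_op (F k) p)"
proof
  let ?K = "\<Union>a\<in>(\<Union>b\<in>Poly_Mapping.keys p. {..b}). {k. mfps_nth (F k) a \<noteq> 0}"
  show "finite ?K"
    using assms by (auto simp: mfps_summable_def)
  fix L assume L: "finite L" "?K \<subseteq> L"
  have "indicator_op (mfps_suminf F) p = indicator_op (\<Sum>k\<in>L. F k) p"
  proof (rule indicator_op_cong)
    fix b a assume "b \<in> Poly_Mapping.keys p" "a \<le> b"
    with L have "{k. mfps_nth (F k) a \<noteq> 0} \<subseteq> L" by blast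
    then show "mfps_nth (mfps_suminf F) a = mfps_nth (\<Sum>k\<in>L. F k) a"
      using L(1) by (auto simp: mfps_suminf_def intro!: sum.mono_neutral_left)
  qed
  then show "indicator_op (mfps_suminf F) p = (\<Sum>k\<in>L. indicator_op (F k) p)"
    by (simp add: indicator_op_sum)
qed

text \<open>On a monomial the infinite sum breaks off, because \<open>mffact b n\<close> vanishes
  unless \<open>n \<le> b\<close>.\<close>

lemma is_indicator_imp_eq:
  fixes T :: "'d::{finite,linorder} mpoly \<Rightarrow> 'd mpoly"
  assumes "linear T" "is_indicator T f"
  shows "T p = indicator_op f p"
proof (rule mpoly_linear_eqI[where p = p])
  fix b :: "'d multiindex"
  have "op_mpow mpoly_deriv n (mpoly_mon b) = mffact b n *\<^sub>R mpoly_mon (b - n)" for n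
    by (rule op_mpow_lowering) (auto simp: linear_mpoly_deriv mpoly_deriv_mono)
  then have "T (mpoly_mon b) = Sum_any (\<lambda>n. (mfps_nth f n * mffact b n) *\<^sub>R mpoly_mon (b - n))"
    using assms(2) by (simp add: is_indicator_def)
  also have "\<dots> = indicator_op f (mpoly_mon b)"
    unfolding indicator_op_mon
    by (rule Sum_any.expand_superset) (auto simp: mffact_def)
  finally show "T (mpoly_mon b) = indicator_op f (mpoly_mon b)" .
qed (auto simp: assms linear_indicator_op)

lemma op_mpow_indicator_op:
  fixes D :: "'d::{finite,linorder} \<Rightarrow> 'd mpoly \<Rightarrow> 'd mpoly"
  assumes "\<And>i p. D i p = indicator_op (f i) p"
  shows "op_mpow D n p = indicator_op (mpow f n) p"
proof -
  have pow: "(D i ^^ r) p = indicator_op (f i ^ r) p" for i r p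
    by (induction r) (auto simp: assms indicator_op_mult)
  have "foldr (\<lambda>i T. (D i ^^ (n $ i)) \<circ> T) xs id p = indicator_op (\<Prod>i\<leftarrow>xs. f i ^ (n $ i)) p" for xs
    by (induction xs) (auto simp: pow indicator_op_mult)
  moreover have "(\<Prod>i\<leftarrow>sorted_list_of_set UNIV. f i ^ (n $ i)) = mpow f n"
    by (simp add: mpow_def prod.distinct_set_conv_list[symmetric])
  ultimately show ?thesis by (simp add: op_mpow_def)
qed

section \<open>The exponential generating function of the basic sequence\<close>

text \<open>By \<open>inv\<close>, the partial derivative is \<open>h\<close> evaluated at the
  operators \<open>D\<close>, and each power of \<open>D\<close> only lowers the index of
  \<open>p\<close>.\<close>

lemma basic_sequence_deriv:
  fixes D :: "'d::{finite,linorder} \<Rightarrow> 'd mpoly \<Rightarrow> 'd mpoly"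
  assumes lin: "\<And>i. linear (D i)"
    and ind: "\<And>i. is_indicator (D i) (f i)"
    and inv: "mfps_compose h f = mfps_X i"
    and basic: "basic_sequence D p"
  shows "mpoly_deriv i (p m) = (\<Sum>n\<le>m. (mfps_nth h n * mffact m n) *\<^sub>R p (m - n))"
proof -
  note D_eq = is_indicator_imp_eq[OF lin ind]
  \<comment> \<open>\<open>D i\<close> annihilates \<open>p 0 = 1\<close>, whereas the operator with
    indicator \<open>f i\<close> maps 1 to the constant term.\<close>
  have f0: "mfps_nth (f i) 0 = 0" for i
  proof -
    have "D i (p 0) = real ((0 :: 'd multiindex) $ i) *\<^sub>R p (0 - axis i 1)"
      using basic unfolding basic_sequence_def by blast
    moreover have "p 0 = mpoly_mon 0"
      using basic by (simp add: basic_sequence_def)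
    moreover have "{..0 :: 'd multiindex} = {0}"
      by (auto simp: mi_le_iff vec_eq_iff)
    ultimately have "mfps_nth (f i) 0 *\<^sub>R mpoly_mon (0 :: 'd multiindex) = 0"
      using indicator_op_mon[of "f i" 0] D_eq[of i "mpoly_mon 0"] by simp
    then show ?thesis by simp
  qed
  have Dp: "indicator_op (mpow f n) (p m) = mffact m n *\<^sub>R p (m - n)" for n
    using basic
    by (subst op_mpow_indicator_op[OF D_eq, symmetric], intro op_mpow_lowering)
       (auto simp: lin basic_sequence_def)
  \<comment> \<open>\<open>mpow f n\<close> has order at least \<open>mdeg n\<close>, so a fixed
    coefficient involves only finitely many \<open>n\<close>.\<close>
  have "mfps_summable (\<lambda>n. mfps_nth h n *\<^sub>R mpow f n)"
    unfolding mfps_summable_def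
  proof
    fix a :: "'d multiindex"
    have "mfps_nth (mpow f n) a = 0" if "mdeg n > mdeg a" for n
      using mfps_order_ge_mpow[of f n] f0 that by (auto simp: mfps_order_ge_def)
    then have "{n. mfps_nth (mfps_nth h n *\<^sub>R mpow f n) a \<noteq> 0} \<subseteq> {n. mdeg n \<le> mdeg a}"
      by (auto simp flip: not_less)
    then show "finite {n. mfps_nth (mfps_nth h n *\<^sub>R mpow f n) a \<noteq> 0}"
      by (rule finite_subset) (rule finite_mdeg_le)
  qed
  then obtain K where K: "finite K"
    "\<And>L. finite L \<Longrightarrow> K \<subseteq> L \<Longrightarrow> indicator_op (mfps_compose h f) (p m)
       = (\<Sum>n\<in>L. indicator_op (mfps_nth h n *\<^sub>R mpow f n) (p m))"
    unfolding mfps_compose_def by (rule indicator_op_suminf[where p = "p m"]) blast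
  \<comment> \<open>The finite set \<open>K\<close> is not explicit, so it is enlarged by all
    \<open>n \<le> m\<close>; indices outside \<open>{..m}\<close> contribute nothing, as
    \<open>mffact m n = 0\<close>.\<close>
  have "mpoly_deriv i (p m) = (\<Sum>n\<in>K \<union> {..m}. (mfps_nth h n * mffact m n) *\<^sub>R p (m - n))"
    using K(2)[of "K \<union> {..m}"] K(1) by (simp add: inv indicator_op_X indicator_op_scaleR Dp)
  also have "\<dots> = (\<Sum>n\<le>m. (mfps_nth h n * mffact m n) *\<^sub>R p (m - n))"
    using K(1) by (intro sum.mono_neutral_right) (auto simp: mffact_def)
  finally show ?thesis .
qed

text \<open>Without constant terms in \<open>g\<close>, the derivatives of \<open>U m\<close>
  involve \<open>U\<close> at smaller indices only. By induction \<open>U m\<close> and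
  \<open>V m\<close> have equal derivatives, hence differ by a constant, which the values at 0 force
  to vanish.\<close>

lemma mpoly_deriv_system_unique:
  fixes U V :: "'d::finite multiindex \<Rightarrow> 'd mpoly"
  assumes g0: "\<And>i. mfps_nth (g i) 0 = 0"
    and U: "\<And>i m. mpoly_deriv i (U m) = (\<Sum>n\<le>m. mfps_nth (g i) n *\<^sub>R U (m - n))"
    and V: "\<And>i m. mpoly_deriv i (V m) = (\<Sum>n\<le>m. mfps_nth (g i) n *\<^sub>R V (m - n))"
    and eq0: "\<And>m. mpoly_eval (U m) 0 = mpoly_eval (V m) 0"
  shows "U m = V m"
proof (induction m rule: mi_induct)
  case (less m)
  \<comment> \<open>The only term containing \<open>U m\<close> itself is \<open>n = 0\<close>,
    whose factor is the constant term of \<open>g i\<close>.\<close>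
  have "mfps_nth (g i) n *\<^sub>R U (m - n) = mfps_nth (g i) n *\<^sub>R V (m - n)" if "n \<le> m" for i n
  proof (cases "n = 0")
    case False
    with that have "m - n \<noteq> m" using mi_le_add_diff(2)[OF that] by auto
    with less show ?thesis by simp
  qed (simp add: g0)
  then have "mpoly_deriv i (U m) = mpoly_deriv i (V m)" for i
    unfolding U V by (intro sum.cong) auto
  then have "mpoly_deriv i (U m - V m) = 0" for i
    by (simp add: linear_diff[OF linear_mpoly_deriv])
  then have "U m - V m = of_real (Poly_Mapping.lookup (U m - V m) 0)" (is "_ = of_real ?c")
    by (rule mpoly_constI)
  moreover have "mpoly_eval (U m - V m) 0 = 0"
    using eq0 by (simp add: mpoly_eval_def linear_diff[OF linear_mpoly_subst])
  ultimately have "?c = 0"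
    by (metis mpoly_eval_def mpoly_subst_of_real of_real_eq_id id_apply)
  then show ?case
    using \<open>U m - V m = of_real ?c\<close> by simp
qed

section \<open>Coefficients of the exponential series\<close>

lemma mfps_nth_dot_zero: "(\<And>i. mfps_nth (g i) 0 = 0) \<Longrightarrow> mfps_nth (mfps_dot u g) 0 = 0"
  by (simp add: mfps_nth_dot)

text \<open>Substitution is an algebra homomorphism, so it passes through the finite sums and
  products that form each coefficient.\<close>

lemma mpoly_subst_mfps_power:
  "mpoly_subst u (mfps_nth (mfps_dot mpoly_X g ^ j) m) = mfps_nth (mfps_dot u g ^ j) m"
proof (induction j arbitrary: m)
  case (Suc j)
  then show ?case
    by (simp add: mfps_nth_mult mfps_nth_dot linear_sum[OF linear_mpoly_subst]
        linear_scale[OF linear_mpoly_subst] mpoly_subst_mult)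
qed (simp add: mfps_nth_one linear_0[OF linear_mpoly_subst])

text \<open>Used with \<open>u\<close> the real zero vector, for values at the origin, and with
  \<open>u\<close> the constants \<open>of_real (Z k $ i)\<close>, for the node
  \<open>Z k\<close>.\<close>

lemma mpoly_subst_exp:
  assumes "\<And>i. mfps_nth (g i) 0 = 0"
  shows "mpoly_subst u (mfps_nth (mfps_exp (mfps_dot mpoly_X g)) m)
    = mfps_nth (mfps_exp (mfps_dot u g)) m"
  by (simp add: mfps_nth_exp[OF _ order_refl] mfps_nth_dot_zero assms linear_sum[OF linear_mpoly_subst]
      linear_scale[OF linear_mpoly_subst] mpoly_subst_mfps_power)

lemma mfps_map_deriv_mult:
  "mfps_map (mpoly_deriv i) (F * G) = mfps_map (mpoly_deriv i) F * G + F * mfps_map (mpoly_deriv i) G"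
  by (rule mfps_eqI)
     (simp add: mfps_nth_mult linear_sum[OF linear_mpoly_deriv] mpoly_deriv_mult sum.distrib)

text \<open>Power rule with inner derivative \<open>g i\<close>, which is what differentiating the
  dot product along \<open>i\<close> leaves. The exponent \<open>Suc j\<close> avoids
  \<open>j - 1\<close>.\<close>

lemma mfps_map_deriv_dot_power:
  "mfps_map (mpoly_deriv i) (mfps_dot mpoly_X g ^ Suc j)
    = real (Suc j) *\<^sub>R (mfps_dot mpoly_X g ^ j * mfps_map of_real (g i))"
proof -
  let ?S = "mfps_dot mpoly_X g"
  have dS: "mfps_map (mpoly_deriv i) ?S = mfps_map of_real (g i)"
  proof (rule mfps_eqI)
    fix n
    have "mfps_nth (mfps_map (mpoly_deriv i) ?S) n
        = (\<Sum>j\<in>UNIV. if j = i then mfps_nth (g i) n *\<^sub>R 1 else 0)"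
      unfolding mfps_nth_map mfps_nth_dot linear_sum[OF linear_mpoly_deriv]
      by (rule sum.cong) (auto simp: linear_scale[OF linear_mpoly_deriv] mpoly_deriv_X)
    then show "mfps_nth (mfps_map (mpoly_deriv i) ?S) n = mfps_nth (mfps_map of_real (g i)) n"
      by (simp add: of_real_def)
  qed
  show ?thesis
  proof (induction j)
    case (Suc j)
    have "mfps_map (mpoly_deriv i) (?S ^ Suc (Suc j))
        = mfps_map of_real (g i) * ?S ^ Suc j
          + ?S * real (Suc j) *\<^sub>R (?S ^ j * mfps_map of_real (g i))"
      by (subst power_Suc, subst mfps_map_deriv_mult, subst Suc.IH) (simp add: dS)
    also have "\<dots> = (1 + real (Suc j)) *\<^sub>R (?S ^ Suc j * mfps_map of_real (g i))"
      unfolding scaleR_add_left by (simp add: mult_ac del: of_nat_Suc)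
    finally show ?case
      by (simp only: of_nat_Suc)
  qed (simp add: dS)
qed

text \<open>Termwise differentiation of the exponential, carried out on finite truncations of the
  series.\<close>

lemma mfps_exp_dot_deriv:
  assumes g0: "\<And>i. mfps_nth (g i) 0 = 0"
  defines "E \<equiv> mfps_nth (mfps_exp (mfps_dot mpoly_X g))"
  shows "mpoly_deriv i (E m) = (\<Sum>n\<le>m. mfps_nth (g i) n *\<^sub>R E (m - n))"
proof -
  let ?S = "mfps_dot mpoly_X g" and ?G = "mfps_map of_real (g i) :: ('a mpoly, 'a) mfps"
  have E: "E n = (\<Sum>j\<le>N. (1 / fact j) *\<^sub>R mfps_nth (?S ^ j) n)" if "mdeg n \<le> N" for n N
    unfolding E_def by (rule mfps_nth_exp) (simp_all add: mfps_nth_dot_zero g0 that)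
  let ?N = "mdeg m"
  \<comment> \<open>One term more than needed is taken, since differentiation lowers the power of
    \<open>?S\<close> by one.\<close>
  have "mpoly_deriv i (E m)
      = (\<Sum>j\<le>Suc ?N. (1 / fact j) *\<^sub>R mfps_nth (mfps_map (mpoly_deriv i) (?S ^ j)) m)"
    by (subst E[of m "Suc ?N"])
       (simp_all add: linear_sum[OF linear_mpoly_deriv] linear_scale[OF linear_mpoly_deriv]
          linear_add[OF linear_mpoly_deriv] del: power_Suc)
  also have "\<dots> = (\<Sum>j\<le>?N. (1 / fact (Suc j)) *\<^sub>R mfps_nth (mfps_map (mpoly_deriv i) (?S ^ Suc j)) m)"
  proof -
    have "mpoly_deriv i 1 = 0"
      using mpoly_deriv_mono[of i 0] by simp
    then have "mpoly_deriv i (mfps_nth (?S ^ 0) m) = 0"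
      by (simp add: mfps_nth_one linear_0[OF linear_mpoly_deriv])
    then show ?thesis
      by (subst sum.atMost_Suc_shift) (simp del: power_Suc power_0)
  qed
  also have "\<dots> = (\<Sum>j\<le>?N. (1 / fact j) *\<^sub>R mfps_nth (?S ^ j * ?G) m)"
    by (intro sum.cong refl) (subst mfps_map_deriv_dot_power, simp)
  also have "\<dots> = (\<Sum>j\<le>?N. \<Sum>k\<le>m. mfps_nth (g i) (m - k) *\<^sub>R (1 / fact j) *\<^sub>R mfps_nth (?S ^ j) k)"
    by (simp add: mfps_nth_mult scaleR_sum_right of_real_def)
  also have "\<dots> = (\<Sum>k\<le>m. mfps_nth (g i) (m - k) *\<^sub>R (\<Sum>j\<le>?N. (1 / fact j) *\<^sub>R mfps_nth (?S ^ j) k))"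
    by (subst sum.swap) (simp add: scaleR_sum_right)
  \<comment> \<open>For \<open>k \<le> m\<close> also \<open>mdeg k \<le> ?N\<close>, so the common
    truncation is exact for every \<open>E k\<close>.\<close>
  also have "\<dots> = (\<Sum>k\<le>m. mfps_nth (g i) (m - k) *\<^sub>R E k)"
    by (intro sum.cong refl) (simp add: E[OF mdeg_mono])
  also have "\<dots> = (\<Sum>n\<le>m. mfps_nth (g i) n *\<^sub>R E (m - n))"
    using sum_mi_flip[of "\<lambda>a b. mfps_nth (g i) a *\<^sub>R E b" m] by simp
  finally show ?thesis .
qed

lemma mfps_exp_dot_eq_basic:
  fixes D :: "'d::{finite,linorder} \<Rightarrow> 'd mpoly \<Rightarrow> 'd mpoly"
  assumes lin: "\<And>i. linear (D i)"
    and ind: "\<And>i. is_indicator (D i) (f i)"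
    and inv: "compositional_inverse f g"
    and basic: "basic_sequence D p"
  shows "mfps_nth (mfps_exp (mfps_dot mpoly_X g)) m = (1 / mfact m) *\<^sub>R p m"
proof (rule mpoly_deriv_system_unique)
  show g0: "mfps_nth (g i) 0 = 0" for i
    using inv by (simp add: compositional_inverse_def)
  show "mpoly_deriv i (mfps_nth (mfps_exp (mfps_dot mpoly_X g)) m)
      = (\<Sum>n\<le>m. mfps_nth (g i) n *\<^sub>R mfps_nth (mfps_exp (mfps_dot mpoly_X g)) (m - n))" for i m
    by (rule mfps_exp_dot_deriv[OF g0])
  show "mpoly_deriv i ((1 / mfact m) *\<^sub>R p m)
      = (\<Sum>n\<le>m. mfps_nth (g i) n *\<^sub>R (1 / mfact (m - n)) *\<^sub>R p (m - n))" for i m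
  proof -
    have "mpoly_deriv i (p m) = (\<Sum>n\<le>m. (mfps_nth (g i) n * mffact m n) *\<^sub>R p (m - n))"
      using inv by (intro basic_sequence_deriv[OF lin ind _ basic]) (simp add: compositional_inverse_def)
    then show ?thesis
      by (auto simp: linear_scale[OF linear_mpoly_deriv] scaleR_sum_right mffact_def intro!: sum.cong)
  qed
  \<comment> \<open>At the origin the exponent is the zero series, so the exponential is 1; this
    matches \<open>p 0 = 1\<close> and the vanishing of the other \<open>p m\<close> at 0.\<close>
  show "mpoly_eval (mfps_nth (mfps_exp (mfps_dot mpoly_X g)) m) 0
      = mpoly_eval ((1 / mfact m) *\<^sub>R p m) 0" for m
  proof -
    have "mfps_dot (\<lambda>i. (0 :: 'd point) $ i) g = 0"
      by (rule mfps_eqI) (simp add: mfps_nth_dot)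
    then have "mpoly_eval (mfps_nth (mfps_exp (mfps_dot mpoly_X g)) m) 0 = mfps_nth (mfps_exp 0) m"
      by (simp only: mpoly_eval_def mpoly_subst_exp[OF g0])
    also have "\<dots> = (if m = 0 then 1 else 0)"
    proof -
      have "(1 / fact j) *\<^sub>R mfps_nth (0 ^ j :: (real, 'd) mfps) m
          = (if j = 0 then mfps_nth (1 :: (real, 'd) mfps) m else 0)" for j
        by (cases j) simp_all
      then have "mfps_nth (mfps_exp 0 :: (real, 'd) mfps) m
          = (\<Sum>j\<le>mdeg m. if j = 0 then mfps_nth (1 :: (real, 'd) mfps) m else 0)"
        by (simp only: mfps_nth_exp[OF mfps_nth_zero order_refl])
      then show ?thesis by (simp add: mfps_nth_one)
    qed
    also have "\<dots> = (1 / mfact m) *\<^sub>R mpoly_eval (p m) 0"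
    proof (cases "m = 0")
      case True
      with basic show ?thesis by (simp add: basic_sequence_def mpoly_eval_def)
    next
      case False
      then have "1 \<le> mdeg m" using mdeg_eq_0_iff[of m] by linarith
      with basic have "mpoly_eval (p m) 0 = 0" by (simp add: basic_sequence_def)
      with False show ?thesis by simp
    qed
    finally show ?thesis
      by (simp add: mpoly_eval_def linear_scale[OF linear_mpoly_subst])
  qed
qed

section \<open>Interpolation\<close>

text \<open>The combinations indexed by all \<open>k \<le> m\<close> form a subspace that contains
  the generators, hence the span.\<close>

lemma delta_space_expand:
  assumes "r \<in> delta_space p m"
  obtains c where "r = (\<Sum>k\<le>m. c k *\<^sub>R p k)"
proof -
  let ?A = "range (\<lambda>c. \<Sum>k\<le>m. c k *\<^sub>R p k)"
  have "p j \<in> ?A" if "j \<le> m" for j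
  proof (rule range_eqI)
    have "(\<Sum>k\<le>m. (if k = j then 1 else 0) *\<^sub>R p k) = (\<Sum>k\<le>m. if k = j then p j else 0)"
      by (rule sum.cong) auto
    with that show "p j = (\<Sum>k\<le>m. (if k = j then 1 else 0) *\<^sub>R p k)" by simp
  qed
  moreover have "subspace ?A"
  proof (rule subspaceI; safe?)
    show "0 \<in> ?A" by (rule range_eqI[of _ _ "\<lambda>_. 0"]) simp
    show "(\<Sum>k\<le>m. c k *\<^sub>R p k) + (\<Sum>k\<le>m. c' k *\<^sub>R p k) \<in> ?A" for c c'
      by (rule range_eqI[of _ _ "\<lambda>k. c k + c' k"]) (simp add: scaleR_add_left sum.distrib)
    show "a *\<^sub>R (\<Sum>k\<le>m. c k *\<^sub>R p k) \<in> ?A" for a c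
      by (rule range_eqI[of _ _ "\<lambda>k. a * c k"]) (simp add: scaleR_sum_right)
  qed
  ultimately have "delta_space p m \<subseteq> ?A"
    unfolding delta_space_def by (intro span_minimal) auto
  with assms that show thesis by blast
qed

text \<open>The conditions are triangular: for a maximal \<open>k\<close> with
  \<open>c k \<noteq> 0\<close>, the operator of index \<open>k\<close> reduces \<open>r\<close> to
  the constant \<open>c k * mfact k\<close>.\<close>

lemma delta_interpolation_unique:
  fixes D :: "'d::{finite,linorder} \<Rightarrow> 'd mpoly \<Rightarrow> 'd mpoly"
  assumes lin: "\<And>i. linear (D i)"
    and basic: "basic_sequence D p"
    and r: "r \<in> delta_space p m"
    and zero: "\<And>k. k \<le> m \<Longrightarrow> mpoly_eval (op_mpow D k r) (Z k) = 0"
  shows "r = 0"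
proof -
  obtain c where c: "r = (\<Sum>k\<le>m. c k *\<^sub>R p k)"
    using delta_space_expand[OF r] .
  have Dp: "op_mpow D k (p n) = mffact n k *\<^sub>R p (n - k)" for k n
    using basic by (intro op_mpow_lowering) (auto simp: lin basic_sequence_def)
  have "{k. k \<le> m \<and> c k \<noteq> 0} = {}" (is "?S = {}")
  proof (rule ccontr)
    assume ne: "?S \<noteq> {}"
    have "finite ?S"
      by (rule finite_subset[of _ "{..m}"]) auto
    from finite_has_maximal[OF this ne] obtain k
      where k: "k \<in> ?S" "\<And>l. l \<in> ?S \<Longrightarrow> k \<le> l \<Longrightarrow> k = l"
      by blast
    have "op_mpow D k r = (\<Sum>l\<le>m. (c l * mffact l k) *\<^sub>R p (l - k))"
      by (simp add: c linear_sum[OF linear_op_mpow[OF lin]] linear_scale[OF linear_op_mpow[OF lin]] Dp)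
    \<comment> \<open>For \<open>l \<noteq> k\<close>, either \<open>k \<le> l\<close> fails and
      \<open>mffact l k = 0\<close>, or maximality gives \<open>c l = 0\<close>.\<close>
    also have "\<dots> = (\<Sum>l\<in>{k}. (c l * mffact l k) *\<^sub>R p (l - k))"
      using k by (intro sum.mono_neutral_right) (auto simp: mffact_def)
    also have "\<dots> = of_real (c k * mfact k)"
      using basic by (simp add: basic_sequence_def mffact_def of_real_def)
    finally have "mpoly_eval (op_mpow D k r) (Z k) = c k * mfact k"
      by (simp add: mpoly_eval_def del: of_real_mult)
    with zero[of k] k(1) show False by simp
  qed
  then show ?thesis
    by (auto simp: c intro!: sum.neutral)
qed

lemma basic_eq_goncarov_sum:
  fixes D :: "'d::{finite,linorder} \<Rightarrow> 'd mpoly \<Rightarrow> 'd mpoly"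
  assumes lin: "\<And>i. linear (D i)"
    and basic: "basic_sequence D p"
    and gonc: "delta_goncarov D p Z t"
  shows "(1 / mfact m) *\<^sub>R p m
    = (\<Sum>k\<le>m. (mpoly_eval (p (m - k)) (Z k) / mfact (m - k)) *\<^sub>R (1 / mfact k) *\<^sub>R t k)"
proof -
  \<comment> \<open>For \<open>k \<le> m\<close>, this is the value of the functional of index
    \<open>k\<close> on \<open>(1 / mfact m) *\<^sub>R p m\<close>, divided by its value
    \<open>mfact k\<close> on \<open>t k\<close>.\<close>
  define a where "a k = mpoly_eval (p (m - k)) (Z k) / mfact (m - k) * (1 / mfact k)" for k
  have Dp: "op_mpow D k (p n) = mffact n k *\<^sub>R p (n - k)" for k n
    using basic by (intro op_mpow_lowering) (auto simp: lin basic_sequence_def)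
  note ls = linear_sum[OF linear_op_mpow[OF lin]] linear_scale[OF linear_op_mpow[OF lin]]
    linear_diff[OF linear_op_mpow[OF lin]]
    linear_sum[OF linear_mpoly_subst] linear_scale[OF linear_mpoly_subst]
    linear_diff[OF linear_mpoly_subst]
  have t: "t k \<in> delta_space p k" for k
    using gonc by (simp add: delta_goncarov_def)
  \<comment> \<open>The definition covers only \<open>j \<le> k\<close>; for other \<open>j\<close>
    the operator kills every \<open>p l\<close> with \<open>l \<le> k\<close>, hence
    \<open>t k\<close>.\<close>
  have Dt: "mpoly_eval (op_mpow D j (t k)) (Z j) = (if j = k then mfact k else 0)" for j k
  proof (cases "j \<le> k")
    case True
    with gonc show ?thesis by (simp add: delta_goncarov_def)
  next
    case False
    obtain c where "t k = (\<Sum>l\<le>k. c l *\<^sub>R p l)"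
      using delta_space_expand[OF t] .
    moreover have "mffact l j = 0" if "l \<le> k" for l
      using that False by (auto simp: mffact_def dest: order_trans)
    ultimately have "op_mpow D j (t k) = 0"
      by (simp add: ls Dp)
    with False show ?thesis
      by (auto simp: mpoly_eval_def linear_0[OF linear_mpoly_subst])
  qed
  let ?r = "(1 / mfact m) *\<^sub>R p m - (\<Sum>k\<le>m. a k *\<^sub>R t k)"
  have "?r = 0"
  proof (rule delta_interpolation_unique[OF lin basic])
    have "delta_space p k \<subseteq> delta_space p m" if "k \<le> m" for k
      unfolding delta_space_def using that by (intro span_mono) (auto intro: order_trans)
    with t have "t k \<in> delta_space p m" if "k \<le> m" for k using that by blast
    moreover have "p m \<in> delta_space p m"
      unfolding delta_space_def by (rule span_base) auto
    ultimately show "?r \<in> delta_space p m"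
      unfolding delta_space_def by (intro span_diff span_sum span_scale) auto
    fix j assume j: "j \<le> m"
    have "mpoly_eval (op_mpow D j ?r) (Z j)
        = 1 / mfact m * mffact m j * mpoly_eval (p (m - j)) (Z j)
          - (\<Sum>k\<le>m. a k * mpoly_eval (op_mpow D j (t k)) (Z j))"
      by (simp add: mpoly_eval_def ls Dp)
    also have "(\<Sum>k\<le>m. a k * mpoly_eval (op_mpow D j (t k)) (Z j))
        = (\<Sum>k\<le>m. if k = j then a j * mfact j else 0)"
      by (rule sum.cong) (auto simp: Dt)
    finally show "mpoly_eval (op_mpow D j ?r) (Z j) = 0"
      using j by (simp add: a_def mffact_def)
  qed
  then show ?thesis
    by (simp add: a_def)
qed

theorem theorem4:
  fixes D :: "'d::{finite,linorder} \<Rightarrow> 'd mpoly \<Rightarrow> 'd mpoly"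
    and f g :: "'d \<Rightarrow> (real, 'd) mfps"
    and Z :: "'d multiindex \<Rightarrow> 'd point"
    and p t :: "'d multiindex \<Rightarrow> 'd mpoly"
  assumes "delta_system D"
    and "\<And>i. is_indicator (D i) (f i)"
    and "compositional_inverse f g"
    and "basic_sequence D p"
    and "delta_goncarov D p Z t"
  shows "mfps_sums
           (\<lambda>k. mfps_const ((1 / mfact k) *\<^sub>R t k) * mpow mfps_X k *
                mfps_exp (mfps_dot (\<lambda>i. of_real (Z k $ i)) g))
           (mfps_exp (mfps_dot mpoly_X g))"
    (is "mfps_sums ?F _")
proof -
  have lin: "linear (D i)" for i
    using assms(1) by (simp add: delta_system_def shift_invariant_def)
  have g0: "mfps_nth (g i) 0 = 0" for i
    using assms(3) by (simp add: compositional_inverse_def)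
  note E = mfps_exp_dot_eq_basic[OF lin assms(2-4)]
  \<comment> \<open>Substituting the node for the variables in the exponential series gives the node
    exponential, so its coefficients are scaled values of \<open>p\<close> at \<open>Z k\<close>;
    the monomial factor shifts them by \<open>k\<close>.\<close>
  have F: "mfps_nth (?F k) m = (if k \<le> m
      then (mpoly_eval (p (m - k)) (Z k) / mfact (m - k)) *\<^sub>R (1 / mfact k) *\<^sub>R t k else 0)" for k m
  proof -
    have "mfps_nth (mfps_exp (mfps_dot (\<lambda>i. of_real (Z k $ i)) g)) n
        = (of_real (mpoly_eval (p n) (Z k) / mfact n) :: 'd mpoly)" for n
    proof -
      have "mfps_nth (mfps_exp (mfps_dot (\<lambda>i. of_real (Z k $ i)) g)) n
          = (mpoly_subst (\<lambda>i. of_real (Z k $ i)) ((1 / mfact n) *\<^sub>R p n) :: 'd mpoly)"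
        unfolding E[symmetric] by (rule mpoly_subst_exp[OF g0, symmetric])
      also have "\<dots> = (1 / mfact n) *\<^sub>R of_real (mpoly_eval (p n) (Z k))"
        unfolding linear_scale[OF linear_mpoly_subst] by (simp only: mpoly_subst_const)
      finally show ?thesis
        by (simp add: of_real_def)
    qed
    then show ?thesis
      by (simp add: mult.assoc mpow_mfps_X mfps_nth_monom_mult of_real_def)
  qed
  \<comment> \<open>Only \<open>k \<le> m\<close> reach the coefficient at \<open>m\<close>, which
    gives summability and reduces the claim to \<open>basic_eq_goncarov_sum\<close>.\<close>
  have sub: "{k. mfps_nth (?F k) m \<noteq> 0} \<subseteq> {..m}" for m
    by (auto simp: F split: if_splits)
  show ?thesis
    unfolding mfps_sums_def
  proof
    show "mfps_summable ?F"
      unfolding mfps_summable_def using sub finite_mi_atMost finite_subset by blast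
    show "mfps_suminf ?F = mfps_exp (mfps_dot mpoly_X g)"
    proof (rule mfps_eqI)
      fix m
      have "mfps_nth (mfps_suminf ?F) m = (\<Sum>k\<le>m. mfps_nth (?F k) m)"
        unfolding mfps_suminf_def mfps_nth_Abs using sub by (intro sum.mono_neutral_left) auto
      also have "\<dots> = (1 / mfact m) *\<^sub>R p m"
        by (simp add: F basic_eq_goncarov_sum[OF lin assms(4,5)])
      finally show "mfps_nth (mfps_suminf ?F) m = mfps_nth (mfps_exp (mfps_dot mpoly_X g)) m"
        by (simp add: E)
    qed
  qed
qed

end
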